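(* For any non-negative integer $N$, $$\begin{aligned} pG(4,1,1;2N)&=rtp(3,3,1;N),\\ pG(4,1,1;4N+1)&=2\,rtp(3,3,2;N)+4\,Tg(3,6,1;N-1),\\ pG(4,1,1;4N+3)&=0. \end{aligned}$$
   Context: $\mathbb{N}_0=\{0,1,2,\dots\}$. $t_n=n(n+1)/2$ (triangular numbers, $n\in\mathbb{N}_0$), $p_n=n(3n+1)/2$ (generalized pentagonal numbers, $n\in\mathbb{Z}$), $g_n=n(3n+2)$ (generalized octagonal numbers, $n\in\mathbb{Z}$). For positive integers $a_1,a_2,a_3$ and an integer $N$: $pG(a_1,a_2,a_3;N)=|\{(l,m,n)\in\mathbb{Z}^3: N=a_1p_l+a_2g_m+a_3g_n\}|$; $rtp(a_1,a_2,a_3;N)=|\{(l,m,n)\in\mathbb{Z}\times\mathbb{N}_0\times\mathbb{Z}: N=a_1l^2+a_2t_m+a_3p_n\}|$; $Tg(a_1,a_2,a_3;N)=|\{(l,m,n)\in\mathbb{N}_0^2\times\mathbb{Z}: N=a_1t_l+a_2t_m+a_3g_n\}|$. In particular these counts are $0$ when $N<0$. *)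

theory Defs
  imports Main
begin

text \<open>The products halved in \<open>tri\<close> and \<open>pent\<close> are even, so \<open>div\<close> is exact division.\<close>

definition tri :: "nat \<Rightarrow> int" where
  "tri n = int n * (int n + 1) div 2"

definition pent :: "int \<Rightarrow> int" where
  "pent n = n * (3 * n + 1) div 2"

definition octa :: "int \<Rightarrow> int" where
  "octa n = n * (3 * n + 2)"

text \<open>
  The coefficients are meant to be positive; the sets counted are then finite
  (proved below), so that \<open>card\<close> is the actual number of solutions.
\<close>

definition pG :: "int \<Rightarrow> int \<Rightarrow> int \<Rightarrow> int \<Rightarrow> nat" where
  "pG a1 a2 a3 N =
     card {(l :: int, m :: int, n :: int). N = a1 * pent l + a2 * octa m + a3 * octa n}"

definition rtp :: "int \<Rightarrow> int \<Rightarrow> int \<Rightarrow> int \<Rightarrow> nat" where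
  "rtp a1 a2 a3 N =
     card {(l :: int, m :: nat, n :: int). N = a1 * l\<^sup>2 + a2 * tri m + a3 * pent n}"

definition Tg :: "int \<Rightarrow> int \<Rightarrow> int \<Rightarrow> int \<Rightarrow> nat" where
  "Tg a1 a2 a3 N =
     card {(l :: nat, m :: nat, n :: int). N = a1 * tri l + a2 * tri m + a3 * octa n}"

lemma sq_ge_abs: "\<bar>n\<bar> \<le> n\<^sup>2" for n :: int
proof (cases "n = 0")
  case False
  then have "\<bar>n\<bar> * 1 \<le> \<bar>n\<bar> * \<bar>n\<bar>" by (intro mult_left_mono) auto
  then show ?thesis by (simp add: power2_eq_square)
qed simp

lemma octa_ge_abs: "\<bar>n\<bar> \<le> octa n"
  using sq_ge_abs[of n] by (simp add: octa_def algebra_simps power2_eq_square)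

lemma pent_ge_abs: "\<bar>n\<bar> \<le> pent n"
proof -
  have "2 * \<bar>n\<bar> \<le> n * (3 * n + 1)"
    using sq_ge_abs[of n] by (simp add: algebra_simps power2_eq_square)
  then show ?thesis by (simp add: pent_def)
qed

lemma tri_ge: "int n \<le> tri n"
proof -
  have "2 * int n \<le> int n * (int n + 1)"
    using sq_ge_abs[of "int n"] by (simp add: algebra_simps power2_eq_square)
  then show ?thesis by (simp add: tri_def)
qed

lemma finite_solutions:
  fixes a1 a2 a3 N :: int
  assumes pos: "a1 > 0" "a2 > 0" "a3 > 0"
    and fin: "\<And>K. finite {x. f x \<le> K}" "\<And>K. finite {y. g y \<le> K}" "\<And>K. finite {z. h z \<le> K}"
    and nonneg: "\<And>x. f x \<ge> 0" "\<And>y. g y \<ge> 0" "\<And>z. h z \<ge> 0"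
  shows "finite {(x, y, z). N = a1 * f x + a2 * g y + a3 * h z}"
proof (rule finite_subset)
  have ge: "t \<le> a * t" if "a > 0" "t \<ge> 0" for a t :: int
    using mult_right_mono[of 1 a t] that by simp
  show "{(x, y, z). N = a1 * f x + a2 * g y + a3 * h z}
          \<subseteq> {x. f x \<le> N} \<times> {y. g y \<le> N} \<times> {z. h z \<le> N}"
  proof clarsimp
    fix x y z
    show "f x \<le> a1 * f x + a2 * g y + a3 * h z \<and> g y \<le> a1 * f x + a2 * g y + a3 * h z \<and>
          h z \<le> a1 * f x + a2 * g y + a3 * h z"
      using ge[OF pos(1) nonneg(1)[of x]] ge[OF pos(2) nonneg(2)[of y]]
        ge[OF pos(3) nonneg(3)[of z]] nonneg(1)[of x] nonneg(2)[of y] nonneg(3)[of z]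
      by linarith
  qed
  show "finite ({x. f x \<le> N} \<times> {y. g y \<le> N} \<times> {z. h z \<le> N})"
    using fin by simp
qed

lemma finite_le_of_ge_abs:
  fixes f :: "int \<Rightarrow> int"
  assumes "\<And>n. \<bar>n\<bar> \<le> f n"
  shows "finite {n. f n \<le> K}"
proof (rule finite_subset)
  show "{n. f n \<le> K} \<subseteq> {-K..K}"
  proof
    fix n assume "n \<in> {n. f n \<le> K}"
    then show "n \<in> {-K..K}" using assms[of n] by auto
  qed
qed simp

lemma finite_tri_le: "finite {n. tri n \<le> K}"
proof (rule finite_subset)
  show "{n. tri n \<le> K} \<subseteq> {..nat K}"
  proof
    fix n assume "n \<in> {n. tri n \<le> K}"
    then show "n \<in> {..nat K}" using tri_ge[of n] by auto
  qed
qed simp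

lemma nonneg_facts: "octa n \<ge> 0" "pent n \<ge> 0" "tri m \<ge> 0"
  using octa_ge_abs[of n] pent_ge_abs[of n] tri_ge[of m] by linarith+

lemmas finite_le_facts =
  finite_le_of_ge_abs[OF sq_ge_abs] finite_le_of_ge_abs[OF octa_ge_abs]
  finite_le_of_ge_abs[OF pent_ge_abs] finite_tri_le

lemma
  fixes a1 a2 a3 N :: int
  assumes "a1 > 0" "a2 > 0" "a3 > 0"
  shows finite_pG: "finite {(l, m, n). N = a1 * pent l + a2 * octa m + a3 * octa n}"
    and finite_rtp: "finite {(l, m, n). N = a1 * l\<^sup>2 + a2 * tri m + a3 * pent n}"
    and finite_Tg: "finite {(l, m, n). N = a1 * tri l + a2 * tri m + a3 * octa n}"
  by (rule finite_solutions; (rule assms finite_le_facts nonneg_facts zero_le_power2))+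

end

theory Submission
  imports Defs
begin

text \<open>
  Completing squares and rotating by 45 degrees turns a sum of two octagonal or two
  pentagonal numbers whose indices have equal parity into a form in half their sum and half
  their difference. The rotation \<open>(j, i) \<mapsto> (i - j, i + j)\<close> gives
  \<open>2 p\<^sub>j + g\<^sub>i = p\<^sub>k + 3 t\<^sub>m\<close> and only reaches \<open>k\<close>, \<open>m\<close> with \<open>k + m\<close> even; but the integers
  \<open>m\<close> and \<open>- m - 1\<close> index the same triangular number and have opposite parity, so that
  exactly one of them is reached. For the argument \<open>4 N + 1\<close> this replaces \<open>p\<^sub>l + 2 p\<^sub>j + g\<^sub>i\<close> by
  the form \<open>p\<^sub>l + p\<^sub>k + 3 t\<^sub>m\<close>, symmetric in \<open>l\<close> and \<open>k\<close>, and the parity of \<open>l - k\<close> separates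
  the two kinds of solutions on the right-hand side.
\<close>

lemma two_tri: "2 * tri n = int n * (int n + 1)"
  by (simp add: tri_def)

lemma two_pent: "2 * pent n = n * (3 * n + 1)"
  by (simp add: pent_def)

text \<open>Folds \<open>z\<close> and \<open>- z - 1\<close> together, so that any integer, in
  particular a sum \<open>i + j\<close>, can index a triangular number.\<close>

definition tri_index :: "int \<Rightarrow> nat" where
  "tri_index z = nat (if z \<ge> 0 then z else - z - 1)"

lemma two_tri_index: "2 * tri (tri_index z) = z * (z + 1)"
  by (simp add: two_tri tri_index_def algebra_simps)

lemma two_pent_add_octa: "2 * pent j + octa i = pent (i - j) + 3 * tri (tri_index (i + j))"
proof -
  have "2 * (2 * pent j + octa i) = 2 * (pent (i - j) + 3 * tri (tri_index (i + j)))"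
    unfolding distrib_left mult.left_commute[of 2 "3 :: int"] mult.left_commute[of 2 "2 :: int"]
      two_pent two_tri_index octa_def
    by algebra
  then show ?thesis by simp
qed

lemma bij_rotate: "bij (\<lambda>(x :: 'a, j, i). (x, i - j, tri_index (i + j)))"
proof (rule bijI)
  show "inj (\<lambda>(x :: 'a, j, i). (x, i - j, tri_index (i + j)))"
  proof (clarsimp simp: inj_def)
    fix j i j' i' :: int
    assume *: "i - j = i' - j'" and "tri_index (i + j) = tri_index (i' + j')"
    then have "i + j = i' + j' \<or> i + j = - (i' + j') - 1"
      by (auto simp: tri_index_def split: if_splits)
    \<comment> \<open>The second alternative gives \<open>i + j\<close> and \<open>i' + j'\<close>
      opposite parities, against the equality of \<open>i - j\<close> and
      \<open>i' - j'\<close>.\<close>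
    with * show "j = j' \<and> i = i'" by presburger
  qed
  show "surj (\<lambda>(x :: 'a, j, i). (x, i - j, tri_index (i + j)))"
  proof (rule surjI)
    fix y :: "'a \<times> int \<times> nat"
    obtain x k m where y: "y = (x, k, m)" by (cases y)
    \<comment> \<open>Of the two integers folded to \<open>m\<close>, \<open>z\<close> picks the one
      with the parity of \<open>k\<close>, so that the rotation can be undone in the
      integers.\<close>
    define z where "z = (\<lambda>(k, m). if even (k + int m) then int m else - int m - 1)"
    have z: "even (k + z (k, m))" "tri_index (z (k, m)) = m"
      by (auto simp: z_def tri_index_def)
    have "(z (k, m) + k) div 2 - (z (k, m) - k) div 2 = k"
      "(z (k, m) + k) div 2 + (z (k, m) - k) div 2 = z (k, m)"
      using z(1) by presburger+
    with z(2) y show "(\<lambda>(x, j, i). (x, i - j, tri_index (i + j)))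
        ((\<lambda>(x, k, m). (x, (z (k, m) - k) div 2, (z (k, m) + k) div 2)) y) = y"
      by simp
  qed
qed

text \<open>The term \<open>f x\<close> stays arbitrary because the exchange serves twice: with
  three times a square for \<open>2 * N\<close>, with \<open>pent l\<close> for
  \<open>4 * N + 1\<close>.\<close>

lemma card_two_pent_octa_eq_card_pent_tri:
  "card {(x, j, i). K = f x + (2 * pent j + octa i)} =
   card {(x, k, m). K = f x + (pent k + 3 * tri m)}" (is "card ?A = card ?B")
proof -
  let ?F = "\<lambda>(x, j, i). (x, i - j, tri_index (i + j))"
  have "?A = ?F -` ?B" by (auto simp: two_pent_add_octa)
  also have "card \<dots> = card ?B"
    using bij_rotate by (intro card_vimage_inj) (auto simp: bij_def)
  finally show ?thesis .
qed

lemma octa_add_sub: "octa (s + d) + octa (s - d) = 2 * octa s + 6 * d\<^sup>2"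
  unfolding octa_def by algebra

lemma pent_add_sub: "pent (s + d) + pent (s - d) = 3 * d\<^sup>2 + 2 * pent s"
proof -
  have "2 * pent (s + d) + 2 * pent (s - d) = 2 * (3 * d\<^sup>2) + 2 * (2 * pent s)"
    unfolding two_pent by algebra
  then show ?thesis by simp
qed

lemma pent_add_eq_tri_octa: "pent (int d - c) + pent (- c - 1 - int d) = 6 * tri d + octa c + 1"
proof -
  have "2 * pent (int d - c) + 2 * pent (- c - 1 - int d) = 6 * (2 * tri d) + 2 * (octa c + 1)"
    unfolding two_pent two_tri octa_def by algebra
  then show ?thesis by simp
qed

lemma octa_even: "octa (2 * j) = 8 * pent j"
proof -
  have "octa (2 * j) = 4 * (2 * pent j)"
    unfolding two_pent octa_def by algebra
  then show ?thesis by simp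
qed

text \<open>Writing an odd index as \<open>- 2 * i - 1\<close> rather than \<open>2 * i + 1\<close>
  makes \<open>octa i\<close> itself appear.\<close>

lemma octa_odd: "octa (- 2 * i - 1) = 4 * octa i + 1"
  unfolding octa_def by algebra

lemma octa_parity: "even (octa n) \<longleftrightarrow> even n"
  by (simp add: octa_def)

lemma octa_mod_4: "octa n mod 4 = (if even n then 0 else 1)"
proof (cases "even n")
  case True
  then obtain j where "n = 2 * j" ..
  then show ?thesis by (simp add: octa_even)
next
  case False
  then obtain i where "n = - 2 * i - 1" by (intro that[of "- ((n + 1) div 2)"]; presburger)
  then show ?thesis using octa_odd[of i] by simp
qed

text \<open>Here \<open>m\<close> and \<open>n\<close> have equal parity; rotating them and halving
  the equation gives \<open>?H\<close>, to which the exchange applies.\<close>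

lemma pG_even: "pG 4 1 1 (2 * N) = rtp 3 3 1 N"
proof -
  let ?H = "{(d, j, i). N = 3 * d\<^sup>2 + (2 * pent j + octa i)}"
  let ?H' = "{(d, k, m). N = 3 * d\<^sup>2 + (pent k + 3 * tri m)}"
  let ?f = "\<lambda>(d, j, i). (j, i + d, i - d) :: int \<times> int \<times> int"
  let ?g = "\<lambda>(d, k, m). (d, m, k) :: int \<times> nat \<times> int"
  have "{(l, m, n). 2 * N = 4 * pent l + 1 * octa m + 1 * octa n} = ?f ` ?H" (is "?A = _")
  proof (intro equalityI subsetI)
    fix v assume "v \<in> ?A"
    then obtain l m n where v: "v = (l, m, n)" and N: "2 * N = 4 * pent l + octa m + octa n"
      by auto
    have "even (octa m + octa n)" using N by presburger
    then have "even (m + n)" by (simp add: octa_parity)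
    then obtain s d where "m = s + d" "n = s - d"
      by (intro that[of "(m + n) div 2" "(m - n) div 2"]; presburger)
    then show "v \<in> ?f ` ?H"
      using N octa_add_sub[of s d] v by (intro image_eqI[of _ _ "(d, l, s)"]) auto
  next
    fix v assume "v \<in> ?f ` ?H"
    then obtain d j i where "v = (j, i + d, i - d)" "N = 3 * d\<^sup>2 + (2 * pent j + octa i)"
      by auto
    then show "v \<in> ?A" using octa_add_sub[of i d] by simp
  qed
  moreover have "inj ?f" by (auto simp: inj_def)
  ultimately have "pG 4 1 1 (2 * N) = card ?H"
    by (simp add: pG_def card_image inj_on_subset)
  moreover have "{(l, m, n). N = 3 * l\<^sup>2 + 3 * tri m + 1 * pent n} = ?g ` ?H'"
    by (auto simp: image_iff)
  moreover have "inj ?g" by (auto simp: inj_def)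
  ultimately show ?thesis
    by (simp add: rtp_def card_image inj_on_subset card_two_pent_octa_eq_card_pent_tri)
qed

text \<open>Exactly one of \<open>m\<close>, \<open>n\<close> is even; the factor 2 counts which
  one.\<close>

lemma pG_4_mod_1: "pG 4 1 1 (4 * N + 1) = 2 * card {(l, j, i). N = pent l + (2 * pent j + octa i)}"
proof -
  let ?A = "{(l, m, n). 4 * N + 1 = 4 * pent l + 1 * octa m + 1 * octa n}"
  let ?H = "{(l, j, i). N = pent l + (2 * pent j + octa i)}"
  let ?f = "\<lambda>(l, j, i). (l, 2 * j, - 2 * i - 1) :: int \<times> int \<times> int"
  let ?g = "\<lambda>(l, j, i). (l, - 2 * i - 1, 2 * j) :: int \<times> int \<times> int"
  have A: "?A = ?f ` ?H \<union> ?g ` ?H"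
  proof (intro equalityI subsetI)
    fix v assume "v \<in> ?A"
    then obtain l m n where v: "v = (l, m, n)" and N: "4 * N + 1 = 4 * pent l + octa m + octa n"
      by auto
    have "odd (octa m + octa n)" using N by presburger
    then have "odd (m + n)" by (simp add: octa_parity)
    then consider j i where "m = 2 * j" "n = - 2 * i - 1" | j i where "m = - 2 * i - 1" "n = 2 * j"
    proof (cases "even m")
      case True
      with \<open>odd (m + n)\<close> show thesis
        by (intro that(1)[of "m div 2" "- ((n + 1) div 2)"]; presburger)
    next
      case False
      with \<open>odd (m + n)\<close> show thesis
        by (intro that(2)[of "- ((m + 1) div 2)" "n div 2"]; presburger)
    qed
    then show "v \<in> ?f ` ?H \<union> ?g ` ?H"
    proof cases
      case 1
      then show ?thesis
        using N v octa_even[of j] octa_odd[of i]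
        by (intro UnI1 image_eqI[of _ _ "(l, j, i)"]) auto
    next
      case 2
      then show ?thesis
        using N v octa_even[of j] octa_odd[of i]
        by (intro UnI2 image_eqI[of _ _ "(l, j, i)"]) auto
    qed
  next
    fix v assume "v \<in> ?f ` ?H \<union> ?g ` ?H"
    then obtain l j i where "v = (l, 2 * j, - 2 * i - 1) \<or> v = (l, - 2 * i - 1, 2 * j)"
      "N = pent l + (2 * pent j + octa i)" by auto
    then show "v \<in> ?A" using octa_even[of j] octa_odd[of i] by auto
  qed
  have "?f ` ?H \<inter> ?g ` ?H = {}" by auto presburger
  moreover have "finite (?f ` ?H)" "finite (?g ` ?H)"
    using finite_pG[of 4 1 1 "4 * N + 1"] unfolding A by simp_all
  moreover have "inj ?f" "inj ?g" by (auto simp: inj_def)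
  ultimately show ?thesis
    unfolding pG_def A by (simp add: card_Un_disjoint card_image inj_on_subset)
qed

text \<open>Even \<open>l - k\<close> yields \<open>?R\<close>; odd \<open>l - k\<close> yields one
  copy of \<open>?T\<close> for each order of \<open>l\<close> and \<open>k\<close>.\<close>

lemma card_pent_pent_tri:
  "card {(l, k, m). N = pent l + (pent k + 3 * tri m)} = rtp 3 3 2 N + 2 * Tg 3 6 1 (N - 1)"
proof -
  let ?H = "{(l, k, m). N = pent l + (pent k + 3 * tri m)}"
  let ?R = "{(l, m, n). N = 3 * l\<^sup>2 + 3 * tri m + 2 * pent n}"
  let ?T = "{(l, m, n). N - 1 = 3 * tri l + 6 * tri m + 1 * octa n}"
  let ?f = "\<lambda>(d, m, s). (s + d, s - d, m) :: int \<times> int \<times> nat"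
  let ?g = "\<lambda>(m, d, c). (int d - c, - c - 1 - int d, m) :: int \<times> int \<times> nat"
  let ?h = "\<lambda>(m, d, c). (- c - 1 - int d, int d - c, m) :: int \<times> int \<times> nat"
  have H: "?H = ?f ` ?R \<union> (?g ` ?T \<union> ?h ` ?T)"
  proof (intro equalityI subsetI)
    fix v assume "v \<in> ?H"
    then obtain l k m where v: "v = (l, k, m)" and N: "N = pent l + pent k + 3 * tri m"
      by auto
    consider "even (l - k)" | "odd (l - k)" "l > k" | "odd (l - k)" "l \<le> k" by linarith
    then show "v \<in> ?f ` ?R \<union> (?g ` ?T \<union> ?h ` ?T)"
    proof cases
      case 1
      then obtain s d where "l = s + d" "k = s - d"
        by (intro that[of "(l + k) div 2" "(l - k) div 2"]; presburger)
      then show ?thesis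
        using v N pent_add_sub[of s d] by (intro UnI1 image_eqI[of _ _ "(d, m, s)"]) auto
    next
      case 2
      \<comment> \<open>Solves the difference and sum equations for \<open>d\<close> and
        \<open>c\<close>; \<open>nat\<close> loses nothing since \<open>l > k\<close>.\<close>
      then have "l = int (nat ((l - k - 1) div 2)) - - ((l + k + 1) div 2)"
        "k = - (- ((l + k + 1) div 2)) - 1 - int (nat ((l - k - 1) div 2))"
        by auto presburger+
      then obtain d c where "l = int d - c" "k = - c - 1 - int d"
        by (rule that)
      then show ?thesis
        using v N pent_add_eq_tri_octa[of d c]
        by (intro UnI2 UnI1 image_eqI[of _ _ "(m, d, c)"]) auto
    next
      case 3
      then have "k = int (nat ((k - l - 1) div 2)) - - ((l + k + 1) div 2)"
        "l = - (- ((l + k + 1) div 2)) - 1 - int (nat ((k - l - 1) div 2))"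
        by auto presburger+
      then obtain d c where "k = int d - c" "l = - c - 1 - int d"
        by (rule that)
      then show ?thesis
        using v N pent_add_eq_tri_octa[of d c]
        by (intro UnI2 image_eqI[of _ _ "(m, d, c)"]) auto
    qed
  next
    fix v assume "v \<in> ?f ` ?R \<union> (?g ` ?T \<union> ?h ` ?T)"
    then consider d m s where "v = (s + d, s - d, m)" "N = 3 * d\<^sup>2 + 3 * tri m + 2 * pent s"
      | m d c where "v = (int d - c, - c - 1 - int d, m)" "N - 1 = 3 * tri m + 6 * tri d + octa c"
      | m d c where "v = (- c - 1 - int d, int d - c, m)" "N - 1 = 3 * tri m + 6 * tri d + octa c"
      by fastforce
    then show "v \<in> ?H"
    proof cases
      case 1
      then show ?thesis using pent_add_sub[of s d] by auto
    next
      case 2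
      then show ?thesis using pent_add_eq_tri_octa[of d c] by auto
    next
      case 3
      then show ?thesis using pent_add_eq_tri_octa[of d c] by auto
    qed
  qed
  \<comment> \<open>The difference of the first two components is even for \<open>?f\<close> and odd
    for \<open>?g\<close> and \<open>?h\<close>; its sign then separates \<open>?g\<close> from
    \<open>?h\<close>.\<close>
  have "?f ` ?R \<inter> (?g ` ?T \<union> ?h ` ?T) = {}" by auto presburger+
  moreover have "?g ` ?T \<inter> ?h ` ?T = {}" by auto
  moreover have "finite ?R" "finite ?T"
    using finite_rtp[of 3 3 2 N] finite_Tg[of 3 6 1 "N - 1"] by simp_all
  moreover have "inj ?f" "inj ?g" "inj ?h" by (auto simp: inj_def)
  ultimately show ?thesis
    unfolding H rtp_def Tg_def by (simp add: card_Un_disjoint card_image inj_on_subset)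
qed

text \<open>Two octagonal numbers sum to 0, 1 or 2 modulo 4.\<close>

lemma pG_4_mod_3: "pG 4 1 1 (4 * N + 3) = 0"
proof -
  have "4 * N + 3 \<noteq> 4 * pent l + 1 * octa m + 1 * octa n" for l m n
    using octa_mod_4[of m] octa_mod_4[of n] by (simp split: if_splits; presburger)
  then have "{(l, m, n). 4 * N + 3 = 4 * pent l + 1 * octa m + 1 * octa n} = {}" by blast
  then show ?thesis unfolding pG_def by (simp only: card.empty)
qed

theorem theorem5p10:
  fixes N :: int
  assumes "N \<ge> 0"
  shows "pG 4 1 1 (2 * N) = rtp 3 3 1 N \<and>
         pG 4 1 1 (4 * N + 1) = 2 * rtp 3 3 2 N + 4 * Tg 3 6 1 (N - 1) \<and>
         pG 4 1 1 (4 * N + 3) = 0"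
  by (simp add: pG_even pG_4_mod_1 card_two_pent_octa_eq_card_pent_tri card_pent_pent_tri
      pG_4_mod_3)

end
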